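(* Let $R$ be a non-singular, irreducible, aperiodic, positive recurrent homogeneous random walk in the quarter-plane, with interior transition probabilities $p_{s,t}$ and axis transition probabilities $h_s$, $v_t$. Suppose that the invariant measure of $R$ is induced by a set $\Gamma\subset U=(0,1)^2$, i.e. it equals $m(i,j)=\sum_{(\rho,\sigma)\in\Gamma}\alpha(\rho,\sigma)\rho^i\sigma^j$ for all $(i,j)\in\mathbb{N}_0^2$ with $\alpha(\rho,\sigma)\in\mathbb{R}\setminus\{0\}$ for all $(\rho,\sigma)\in\Gamma$, where $$\sum_{(\rho,\sigma)\in\Gamma}|\alpha(\rho,\sigma)|\frac{1}{1-\rho}\frac{1}{1-\sigma}<\infty .$$ Suppose moreover that for any $(\rho,\sigma)\in\Gamma$ there exists $(w,v)\in\mathbb{N}^2$ such that $\tilde\rho^{w}\tilde\sigma^{v}\neq\rho^w\sigma^v$ for all $(\tilde\rho,\tilde\sigma)\in\Gamma\setminus\{(\rho,\sigma)\}$. Then $\Gamma\subset Q_U^{+}$.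
   Context: Notation: $\mathbb{N}_0=\{0,1,2,\dots\}$, $\mathbb{N}=\{1,2,\dots\}$. Random walk. $R$ is a discrete-time Markov chain on $S=\{(i,j): i,j\in\mathbb{N}_0\}$; $p_{s,t}(i,j)$ is the probability of going from $(i,j)$ to $(i+s,j+t)$, and it is zero if $|s|>1$ or $|t|>1$. The interior is $\{i>0,j>0\}$, the horizontal axis is $\{i>0,j=0\}$, the vertical axis is $\{i=0,j>0\}$. The walk is homogeneous: for each two states $(i,j),(k,l)$ both in the interior (respectively both on the horizontal axis, both on the vertical axis), $p_{s,t}(i,j)=p_{s,t}(k,l)$ and $p_{s,t}(i-s,j-t)=p_{s,t}(k-s,l-t)$ for all $s,t\in\{-1,0,1\}$. For $i,j>0$ write $p_{s,t}=p_{s,t}(i,j)$, $h_s=p_{s,0}(i,0)$, $v_t=p_{0,t}(0,j)$. Consequently transitions from the horizontal axis into the row $j=1$ have probabilities $p_{s,1}$, transitions from the vertical axis into the column $i=1$ have probabilities $p_{1,t}$, and from the origin one goes to $(1,0),(0,1),(1,1)$ with probabilities $h_1,v_1,p_{1,1}$. Invariant measure. A positive finite measure $m$ on $S$ is invariant if it satisfies the balance equations, for all $i,j>0$: $m(i,j)=\sum_{s,t=-1}^{1}m(i-s,j-t)p_{s,t}$; $m(i,0)=\sum_{s=-1}^1 m(i-s,1)p_{s,-1}+\sum_{s=-1}^1 m(i-s,0)h_s$; $m(0,j)=\sum_{t=-1}^1 m(1,j-t)p_{-1,t}+\sum_{t=-1}^1 m(0,j-t)v_t$ (balance at the origin is implied).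 Curve. $Q(x,y)=xy\big(\sum_{s=-1}^{1}\sum_{t=-1}^{1}x^{-s}y^{-t}p_{s,t}-1\big)$, a polynomial; $Q$ also denotes $\{(x,y)\in\mathbb{R}^2: Q(x,y)=0\}$; $Q^+=Q\cap[0,\infty)^2$; $U=(0,1)^2$; $Q_U^+=Q^+\cap U$. Singular walk. $R$ is singular if the polynomial $Q(x,y)$ is reducible or of degree $1$ in at least one of the variables. *)

theory Defs
  imports "HOL-Probability.Probability" "HOL-Computational_Algebra.Computational_Algebra"
begin

type_synonym state = "nat \<times> nat"

primrec n_step :: "('a \<Rightarrow> 'a pmf) \<Rightarrow> nat \<Rightarrow> 'a \<Rightarrow> 'a pmf" where
  "n_step K 0 x = return_pmf x"
| "n_step K (Suc n) x = bind_pmf (K x) (n_step K n)"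

definition irreducible_chain :: "('a \<Rightarrow> 'a pmf) \<Rightarrow> bool" where
  "irreducible_chain K \<longleftrightarrow> (\<forall>x y. \<exists>n. pmf (n_step K n x) y > 0)"

definition aperiodic_chain :: "('a \<Rightarrow> 'a pmf) \<Rightarrow> bool" where
  "aperiodic_chain K \<longleftrightarrow> (\<forall>x. Gcd {n. n > 0 \<and> pmf (n_step K n x) x > 0} = 1)"

text \<open>\<open>first_passage K n x y\<close> is the probability that the chain started in \<open>x\<close> visits \<open>y\<close>
  at time \<open>n + 1\<close> for the first time after time \<open>0\<close>.\<close>

primrec first_passage :: "('a \<Rightarrow> 'a pmf) \<Rightarrow> nat \<Rightarrow> 'a \<Rightarrow> 'a \<Rightarrow> real" where
  "first_passage K 0 x y = pmf (K x) y"
| "first_passage K (Suc n) x y =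
    measure_pmf.expectation (K x) (\<lambda>z. if z = y then 0 else first_passage K n z y)"

text \<open>Every state is revisited almost surely, with finite mean return time.\<close>

definition positive_recurrent_chain :: "('a \<Rightarrow> 'a pmf) \<Rightarrow> bool" where
  "positive_recurrent_chain K \<longleftrightarrow>
    (\<forall>x. (\<lambda>n. first_passage K n x x) sums 1 \<and>
         summable (\<lambda>n. real (n + 1) * first_passage K n x x))"

text \<open>The probability $p_{s,t}(i,j)$ of a jump from $(i,j)$ to $(i+s,j+t)$. It is a function of
  integers, being zero if either end point lies outside the quarter-plane; in \<open>homogeneous_walk\<close>
  the states $(i-s,j-t)$ may do so.\<close>

definition jump_prob :: "(state \<Rightarrow> state pmf) \<Rightarrow> int \<Rightarrow> int \<Rightarrow> int \<Rightarrow> int \<Rightarrow> real" where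
  "jump_prob K s t i j =
    (if 0 \<le> i \<and> 0 \<le> j \<and> 0 \<le> i + s \<and> 0 \<le> j + t
     then pmf (K (nat i, nat j)) (nat (i + s), nat (j + t)) else 0)"

definition interior_states :: "(int \<times> int) set" where
  "interior_states = {(i, j). i > 0 \<and> j > 0}"

definition horizontal_axis :: "(int \<times> int) set" where
  "horizontal_axis = {(i, j). i > 0 \<and> j = 0}"

definition vertical_axis :: "(int \<times> int) set" where
  "vertical_axis = {(i, j). i = 0 \<and> j > 0}"

definition homogeneous_walk :: "(state \<Rightarrow> state pmf) \<Rightarrow> bool" where
  "homogeneous_walk K \<longleftrightarrow>
    (\<forall>i j s t. \<bar>s\<bar> > 1 \<or> \<bar>t\<bar> > 1 \<longrightarrow> jump_prob K s t i j = 0) \<and>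
    (\<forall>A \<in> {interior_states, horizontal_axis, vertical_axis}.
       \<forall>(i, j) \<in> A. \<forall>(k, l) \<in> A. \<forall>s \<in> {-1, 0, 1}. \<forall>t \<in> {-1, 0, 1}.
         jump_prob K s t i j = jump_prob K s t k l \<and>
         jump_prob K s t (i - s) (j - t) = jump_prob K s t (k - s) (l - t))"

text \<open>$p_{s,t}$, $h_s$ and $v_t$; for a homogeneous walk the representative states
  $(1,1)$, $(1,0)$, $(0,1)$ are immaterial.\<close>

definition int_prob :: "(state \<Rightarrow> state pmf) \<Rightarrow> int \<Rightarrow> int \<Rightarrow> real" where
  "int_prob K s t = jump_prob K s t 1 1"

definition hor_prob :: "(state \<Rightarrow> state pmf) \<Rightarrow> int \<Rightarrow> real" where
  "hor_prob K s = jump_prob K s 0 1 0"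

definition ver_prob :: "(state \<Rightarrow> state pmf) \<Rightarrow> int \<Rightarrow> real" where
  "ver_prob K t = jump_prob K 0 t 0 1"

text \<open>The arguments of \<open>nat\<close> below are nonnegative. The balance equation at the origin is
  implied by the others.\<close>

definition invariant_measure :: "(state \<Rightarrow> state pmf) \<Rightarrow> (state \<Rightarrow> real) \<Rightarrow> bool" where
  "invariant_measure K m \<longleftrightarrow>
    (\<forall>x. m x \<ge> 0) \<and> (\<exists>x. m x \<noteq> 0) \<and> m summable_on UNIV \<and>
    (\<forall>i > 0. \<forall>j > 0. m (nat i, nat j) =
       (\<Sum>s = -1..1. \<Sum>t = -1..1. m (nat (i - s), nat (j - t)) * int_prob K s t)) \<and>
    (\<forall>i > 0. m (nat i, 0) =
       (\<Sum>s = -1..1. m (nat (i - s), 1) * int_prob K s (-1)) +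
       (\<Sum>s = -1..1. m (nat (i - s), 0) * hor_prob K s)) \<and>
    (\<forall>j > 0. m (0, nat j) =
       (\<Sum>t = -1..1. m (1, nat (j - t)) * int_prob K (-1) t) +
       (\<Sum>t = -1..1. m (0, nat (j - t)) * ver_prob K t))"

text \<open>$Q(x,y)$ as a polynomial in $y$ whose coefficients are polynomials in $x$.\<close>

definition Q_poly :: "(state \<Rightarrow> state pmf) \<Rightarrow> real poly poly" where
  "Q_poly K =
    (\<Sum>s = -1..1. \<Sum>t = -1..1. monom (monom (int_prob K s t) (nat (1 - s))) (nat (1 - t)))
    - monom (monom 1 1) 1"

definition Q_eval :: "(state \<Rightarrow> state pmf) \<Rightarrow> real \<Rightarrow> real \<Rightarrow> real" where
  "Q_eval K x y = poly (poly (Q_poly K) [:y:]) x"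

lemma Q_eval_eq:
  assumes "x \<noteq> 0" "y \<noteq> 0"
  shows "Q_eval K x y =
    x * y * ((\<Sum>s = -1..1. \<Sum>t = -1..1. x powi (-s) * y powi (-t) * int_prob K s t) - 1)"
proof -
  have "{-1..1::int} = {-1, 0, 1}" by auto
  then show ?thesis
    using assms
    by (simp add: Q_eval_def Q_poly_def poly_monom power_int_minus field_simps power2_eq_square
        numeral_2_eq_2)
qed

definition degree_inner :: "'a::zero poly poly \<Rightarrow> nat" where
  "degree_inner q = Max (range (\<lambda>n. degree (coeff q n)))"

definition singular_walk :: "(state \<Rightarrow> state pmf) \<Rightarrow> bool" where
  "singular_walk K \<longleftrightarrow>
    \<not> irreducible (Q_poly K) \<or> degree_inner (Q_poly K) = 1 \<or> degree (Q_poly K) = 1"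

definition Q_curve :: "(state \<Rightarrow> state pmf) \<Rightarrow> (real \<times> real) set" where
  "Q_curve K = {(x, y). Q_eval K x y = 0}"

definition Q_plus :: "(state \<Rightarrow> state pmf) \<Rightarrow> (real \<times> real) set" where
  "Q_plus K = Q_curve K \<inter> ({0..} \<times> {0..})"

definition unit_square :: "(real \<times> real) set" where
  "unit_square = {0<..<1} \<times> {0<..<1}"

definition Q_plus_U :: "(state \<Rightarrow> state pmf) \<Rightarrow> (real \<times> real) set" where
  "Q_plus_U K = Q_plus K \<inter> unit_square"

end

theory Submission
  imports Defs
begin

text \<open>The interior balance equations say that \<open>\<beta> = \<alpha> Q\<close> satisfies
  \<open>\<Sum> \<beta>(\<rho>,\<sigma>) \<rho>\<^sup>i \<sigma>\<^sup>j = 0\<close> for all \<open>i, j\<close>. Along the multiples of \<open>(w, v)\<close> this says that the signed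
  measure with mass \<open>\<beta>(\<rho>,\<sigma>)\<close> at \<open>\<rho>\<^sup>w \<sigma>\<^sup>v\<close> has vanishing moments, so it vanishes; by the choice of
  \<open>(w, v)\<close>, its mass at this point comes from \<open>(\<rho>,\<sigma>)\<close> alone.\<close>

text \<open>Induction on \<open>p\<close> with \<open>b\<close> arbitrary: in the step for
  \<open>pCons a p\<close> one factor \<open>z x\<close> is absorbed into the weight, because
  \<open>b x * z x\<close> again has vanishing moments, those of \<open>b\<close> shifted by
  one.\<close>

lemma has_sum_poly_vanishing_moments:
  fixes b z :: "'a \<Rightarrow> real"
  assumes "\<And>k. ((\<lambda>x. b x * z x ^ k) has_sum 0) A"
  shows "((\<lambda>x. b x * poly p (z x)) has_sum 0) A"
  using assms
proof (induction p arbitrary: b)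
  case 0
  then show ?case by simp
next
  case (pCons a p)
  have "((\<lambda>x. b x * z x * z x ^ k) has_sum 0) A" for k
    using pCons.prems[of "Suc k"] by (simp add: mult.assoc)
  then have 1: "((\<lambda>x. b x * z x * poly p (z x)) has_sum 0) A"
    by (rule pCons.IH)
  have "((\<lambda>x. a * (b x * z x ^ 0)) has_sum a * 0) A"
    by (intro has_sum_cmult_right pCons.prems)
  then show ?case
    using has_sum_add[OF _ 1, of "\<lambda>x. a * b x" 0] by (simp add: algebra_simps)
qed

text \<open>Polynomials peaking at \<open>z x0\<close> are paired with \<open>b\<close>; in the
  limit only the term at \<open>x0\<close> survives. The values \<open>z x\<close> may accumulate at
  \<open>z x0\<close>, so the convergence is only pointwise and is exchanged with the sum by
  dominated convergence.\<close>

lemma vanishing_moments_imp_zero: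
  fixes b z :: "'a \<Rightarrow> real"
  assumes moments: "\<And>k. ((\<lambda>x. b x * z x ^ k) has_sum 0) A"
    and z: "\<And>x. x \<in> A \<Longrightarrow> z x \<in> {0..1}"
    and x0: "x0 \<in> A" "\<And>x. x \<in> A - {x0} \<Longrightarrow> z x \<noteq> z x0"
  shows "b x0 = 0"
proof -
  \<comment> \<open>Polynomials converging boundedly on \<open>[0,1]\<close> to the indicator function of \<open>z x0\<close>.\<close>
  define f where "f n t = (1 - (t - z x0)\<^sup>2) ^ n" for n :: nat and t
  have f_poly: "f n t = poly ([:1 - (z x0)\<^sup>2, 2 * z x0, -1:] ^ n) t" for n t
    by (simp add: f_def power2_eq_square algebra_simps)
  have f_sum: "((\<lambda>x. b x * f n (z x)) has_sum 0) A" for n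
    unfolding f_poly by (intro has_sum_poly_vanishing_moments moments)
  \<comment> \<open>Two points of \<open>[0,1]\<close> differ by at most 1, so the base of the power
    in \<open>f\<close> lies in \<open>[0,1]\<close>; it equals 1 only at
    \<open>z x0\<close>.\<close>
  have sq: "(z x - z x0)\<^sup>2 \<le> 1" if "x \<in> A" for x
    using z[OF that] z[OF x0(1)] by (auto simp: abs_square_le_1)
  have f_le: "\<bar>f n (z x)\<bar> \<le> 1" if "x \<in> A" for x n
    unfolding f_def power_abs using sq[OF that] by (intro power_le_one) auto
  have f_lim: "(\<lambda>n. f n (z x)) \<longlonglongrightarrow> indicator {x0} x" if "x \<in> A" for x
  proof (cases "x = x0")
    case False
    then have "(z x - z x0)\<^sup>2 > 0"
      using x0(2) that by simp
    then show ?thesis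
      using False sq[OF that] by (auto simp: f_def intro!: LIMSEQ_power_zero)
  qed (simp add: f_def)
  \<comment> \<open>Unconditional convergence of a real series is absolute, which turns
    \<open>has_sum\<close> into integrability for the counting measure.\<close>
  have abs_summable: "Infinite_Set_Sum.abs_summable_on g A" if "(g has_sum c) A" for g :: "'a \<Rightarrow> real" and c
    using has_sum_imp_summable[OF that]
    by (metis abs_summable_equivalent summable_on_iff_abs_summable_on_real)
  \<comment> \<open>The moment \<open>k = 0\<close> supplies the integrable majorant.\<close>
  have b_int: "integrable (count_space A) b"
    using abs_summable[OF moments[of 0]] by (simp add: Infinite_Set_Sum.abs_summable_on_def)
  have "(\<lambda>n. \<integral>x. b x * f n (z x) \<partial>count_space A)
      \<longlonglongrightarrow> (\<integral>x. b x * indicator {x0} x \<partial>count_space A)"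
  proof (rule integral_dominated_convergence[where w = "\<lambda>x. \<bar>b x\<bar>"])
    show "AE x in count_space A. (\<lambda>n. b x * f n (z x)) \<longlonglongrightarrow> b x * indicator {x0} x"
      by (auto simp: AE_count_space intro!: tendsto_intros f_lim)
    show "AE x in count_space A. norm (b x * f n (z x)) \<le> \<bar>b x\<bar>" for n
      using f_le by (auto simp: AE_count_space abs_mult intro!: mult_left_le)
  qed (use b_int in auto)
  moreover have "(\<integral>x. b x * f n (z x) \<partial>count_space A) = 0" for n
  proof -
    have "infsetsum (\<lambda>x. b x * f n (z x)) A = 0"
      using infsetsum_infsum[OF abs_summable[OF f_sum]] infsumI[OF f_sum] by simp
    then show ?thesis
      by (simp add: infsetsum_def)
  qed
  moreover have "(\<integral>x. b x * indicator {x0} x \<partial>count_space A) = b x0"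
  proof -
    have "(\<integral>x. b x * indicator {x0} x \<partial>count_space A) = infsetsum (\<lambda>x. b x * indicator {x0} x) A"
      by (simp add: infsetsum_def)
    also have "\<dots> = infsetsum b {x0}"
      using x0(1) by (intro infsetsum_cong_neutral) auto
    finally show ?thesis by simp
  qed
  ultimately show ?thesis
    by (simp add: LIMSEQ_const_iff)
qed

lemma has_sum_sum:
  fixes f :: "'i \<Rightarrow> 'a \<Rightarrow> 'b :: topological_comm_monoid_add"
  assumes "\<And>i. i \<in> I \<Longrightarrow> (f i has_sum c i) A"
  shows "((\<lambda>x. \<Sum>i\<in>I. f i x) has_sum (\<Sum>i\<in>I. c i)) A"
  using assms by (induction I rule: infinite_finite_induct) (auto intro: has_sum_add)

lemma Q_eval_sum:
  "Q_eval K x y =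
    (\<Sum>s = -1..1. \<Sum>t = -1..1. int_prob K s t * x ^ nat (1 - s) * y ^ nat (1 - t)) - x * y"
  by (simp add: Q_eval_def Q_poly_def poly_sum poly_monom)

text \<open>The product form is inserted into the interior balance equation at
  \<open>(i + 1, j + 1)\<close>. Every term contains \<open>\<rho> ^ i * \<sigma> ^ j\<close>, and
  what remains is \<open>\<alpha>\<close> times Q: the prefactor xy of Q is the shift by one in both
  coordinates.\<close>

lemma product_form_balance:
  assumes inv: "invariant_measure K m"
    and m: "\<And>i j. ((\<lambda>(\<rho>, \<sigma>). \<alpha> (\<rho>, \<sigma>) * \<rho> ^ i * \<sigma> ^ j) has_sum m (i, j)) \<Gamma>"
  shows "((\<lambda>(\<rho>, \<sigma>). \<alpha> (\<rho>, \<sigma>) * Q_eval K \<rho> \<sigma> * \<rho> ^ i * \<sigma> ^ j) has_sum 0) \<Gamma>"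
proof -
  let ?f = "\<lambda>i j \<gamma>. \<alpha> \<gamma> * fst \<gamma> ^ i * snd \<gamma> ^ j"
  let ?g = "\<lambda>\<gamma>. (\<Sum>s = -1..1. \<Sum>t = -1..1.
      ?f (i + nat (1 - s)) (j + nat (1 - t)) \<gamma> * int_prob K s t) + - ?f (Suc i) (Suc j) \<gamma>"
  have m': "(?f i j has_sum m (i, j)) \<Gamma>" for i j
    using m[of i j] by (simp add: case_prod_unfold)
  have "(?g has_sum (\<Sum>s = -1..1. \<Sum>t = -1..1.
      m (i + nat (1 - s), j + nat (1 - t)) * int_prob K s t) + - m (Suc i, Suc j)) \<Gamma>"
    by (intro has_sum_add has_sum_uminusI has_sum_sum has_sum_cmult_left m')
  moreover have "m (Suc i, Suc j) = (\<Sum>s = -1..1. \<Sum>t = -1..1.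
      m (i + nat (1 - s), j + nat (1 - t)) * int_prob K s t)"
  proof -
    have "m (nat (int (Suc i)), nat (int (Suc j))) = (\<Sum>s = -1..1. \<Sum>t = -1..1.
        m (nat (int (Suc i) - s), nat (int (Suc j) - t)) * int_prob K s t)"
    proof -
      have "int (Suc i) > 0" "int (Suc j) > 0"
        by simp_all
      with inv show ?thesis
        unfolding invariant_measure_def by blast
    qed
    also have "\<dots> = (\<Sum>s = -1..1. \<Sum>t = -1..1.
        m (i + nat (1 - s), j + nat (1 - t)) * int_prob K s t)"
    proof (intro sum.cong refl)
      \<comment> \<open>As \<open>s\<close> and \<open>t\<close> are at most 1, the differences are
        nonnegative and \<open>nat\<close> truncates nothing.\<close>
      fix s t :: int
      assume "s \<in> {-1..1}" "t \<in> {-1..1}"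
      then have "nat (int (Suc i) - s) = i + nat (1 - s)" "nat (int (Suc j) - t) = j + nat (1 - t)"
        by auto
      then show "m (nat (int (Suc i) - s), nat (int (Suc j) - t)) * int_prob K s t =
          m (i + nat (1 - s), j + nat (1 - t)) * int_prob K s t"
        by simp
    qed
    finally show ?thesis by (simp only: nat_int)
  qed
  moreover have "?g \<gamma> = (case \<gamma> of (\<rho>, \<sigma>) \<Rightarrow> \<alpha> (\<rho>, \<sigma>) * Q_eval K \<rho> \<sigma> * \<rho> ^ i * \<sigma> ^ j)" for \<gamma>
    by (cases \<gamma>) (simp add: Q_eval_sum algebra_simps power_add sum_distrib_left sum_distrib_right)
  ultimately show ?thesis by simp
qed

theorem theorem14:
  fixes K :: "state \<Rightarrow> state pmf"
    and m :: "state \<Rightarrow> real"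
    and \<Gamma> :: "(real \<times> real) set"
    and \<alpha> :: "real \<times> real \<Rightarrow> real"
  assumes "homogeneous_walk K"
    and "\<not> singular_walk K"
    and "irreducible_chain K"
    and "aperiodic_chain K"
    and "positive_recurrent_chain K"
    and "invariant_measure K m"
    and "\<Gamma> \<subseteq> unit_square"
    and "\<forall>\<gamma> \<in> \<Gamma>. \<alpha> \<gamma> \<noteq> 0"
    and "(\<lambda>(\<rho>, \<sigma>). \<bar>\<alpha> (\<rho>, \<sigma>)\<bar> * (1 / (1 - \<rho>)) * (1 / (1 - \<sigma>))) summable_on \<Gamma>"
    and "\<forall>i j. ((\<lambda>(\<rho>, \<sigma>). \<alpha> (\<rho>, \<sigma>) * \<rho> ^ i * \<sigma> ^ j) has_sum m (i, j)) \<Gamma>"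
    and "\<forall>(\<rho>, \<sigma>) \<in> \<Gamma>. \<exists>w v :: nat. w > 0 \<and> v > 0 \<and>
           (\<forall>(\<rho>', \<sigma>') \<in> \<Gamma> - {(\<rho>, \<sigma>)}. \<rho>' ^ w * \<sigma>' ^ v \<noteq> \<rho> ^ w * \<sigma> ^ v)"
  shows "\<Gamma> \<subseteq> Q_plus_U K"
proof
  fix \<gamma> assume "\<gamma> \<in> \<Gamma>"
  then obtain \<rho> \<sigma> where \<gamma>: "\<gamma> = (\<rho>, \<sigma>)" "(\<rho>, \<sigma>) \<in> \<Gamma>"
    by (cases \<gamma>) auto
  obtain w v :: nat where wv:
    "\<And>\<rho>' \<sigma>'. (\<rho>', \<sigma>') \<in> \<Gamma> - {(\<rho>, \<sigma>)} \<Longrightarrow> \<rho>' ^ w * \<sigma>' ^ v \<noteq> \<rho> ^ w * \<sigma> ^ v"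
    using assms(11) \<gamma>(2) by fast
  let ?b = "\<lambda>\<gamma>. \<alpha> \<gamma> * Q_eval K (fst \<gamma>) (snd \<gamma>)"
  let ?z = "\<lambda>\<gamma>. fst \<gamma> ^ w * snd \<gamma> ^ v :: real"
  have "?b (\<rho>, \<sigma>) = 0"
  proof (rule vanishing_moments_imp_zero[where z = ?z])
    \<comment> \<open>The relation with exponents \<open>w * k\<close> and \<open>v * k\<close> is
      the \<open>k\<close>-th moment of the masses \<open>?b\<close> at the points
      \<open>?z\<close>.\<close>
    show "((\<lambda>\<gamma>. ?b \<gamma> * ?z \<gamma> ^ k) has_sum 0) \<Gamma>" for k
      using product_form_balance[OF assms(6) assms(10)[rule_format], of "w * k" "v * k"]
      by (simp add: case_prod_unfold power_mult power_mult_distrib mult.assoc)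
    show "?z \<gamma> \<in> {0..1}" if "\<gamma> \<in> \<Gamma>" for \<gamma>
      using assms(7) that by (auto simp: unit_square_def power_le_one mult_le_one)
      show "?z \<gamma> \<noteq> ?z (\<rho>, \<sigma>)" if "\<gamma> \<in> \<Gamma> - {(\<rho>, \<sigma>)}" for \<gamma>
      using wv[of "fst \<gamma>" "snd \<gamma>"] that unfolding prod.collapse fst_conv snd_conv by blast
  qed (fact \<gamma>(2))
  then have "Q_eval K \<rho> \<sigma> = 0"
    using assms(8) \<gamma>(2) by auto
  then show "\<gamma> \<in> Q_plus_U K"
    using \<gamma> assms(7) by (auto simp: Q_plus_U_def Q_plus_def Q_curve_def unit_square_def)
qed

end
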